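(* There is a simple model $M$ such that: no $M$-predicate $H$ satisfies $\mathrm{True}_M^+=\Phi_M(H)\cap\mathrm{Sent}_M^+$ (T-Tarski$^+$ holds); no $M$-predicate $H$ satisfies $\Phi_M(H)=\mathrm{False}_M$ (F-Tarski holds); but some $M$-predicate $H$ satisfies $\mathrm{False}_M^+=\Phi_M(H)\cap\mathrm{Sent}_M^+$ (F-Tarski$^+$ fails).
   Context: For a non-empty set $\Sigma$ of symbols, $\Sigma^\ast$ is the set of all finite strings over $\Sigma$, including the empty string; $XY$ denotes concatenation. Fix a symbol $\sharp$. A simple model is a pair $M=(\Sigma_M,\Phi_M)$ where $\Sigma_M$ is a set of symbols with $\sharp\in\Sigma_M$, and, putting $\mathrm{Pred}_M=\{X\sharp : X\in\Sigma_M^\ast \text{ and } X \text{ does not contain } \sharp\}$, $\Phi_M$ is a function $\mathrm{Pred}_M\to\mathcal{P}(\Sigma_M^\ast)$. Elements of $\mathrm{Pred}_M$ are called $M$-predicates. $\mathrm{Sent}_M=\{HX : H\in\mathrm{Pred}_M, X\in\Sigma_M^\ast\}$ is the set of $M$-sentences (the decomposition $HX$ is unique), and $\mathrm{Sent}_M^+=\mathrm{Sent}_M\setminus\mathrm{Pred}_M$. $\mathrm{True}_M=\{HX\in\mathrm{Sent}_M : H\in\mathrm{Pred}_M, X\in\Phi_M(H)\}$, $\mathrm{True}_M^+=\mathrm{True}_M\cap\mathrm{Sent}_M^+$, $\mathrm{False}_M=\mathrm{Sent}_M\setminus\mathrm{True}_M$, $\mathrm{False}_M^+=\mathrm{Sent}_M^+\setminus\mathrm{True}_M^+$.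 *)

theory Defs
  imports "HOL-Library.FuncSet"
begin

text \<open>
  Symbols are the elements of a type \<open>'a\<close>, strings are lists, and \<open>\<Sigma>\<^sup>*\<close> is \<^term>\<open>lists \<Sigma>\<close>. The fixed
  symbol \<open>\<sharp>\<close> is an explicit parameter \<open>s\<close>, since it does not depend on the model.
\<close>

record 'a model =
  symbols :: "'a set"
  ext :: "'a list \<Rightarrow> 'a list set"

definition preds :: "'a \<Rightarrow> 'a model \<Rightarrow> 'a list set"
  where "preds s M = {X @ [s] | X. X \<in> lists (symbols M) \<and> s \<notin> set X}"

text \<open>The map \<open>\<Phi>\<close> of a model has domain \<open>Pred\<close>; \<^term>\<open>ext M\<close> is therefore normalised to
  \<^term>\<open>undefined\<close> elsewhere (extensional function space).\<close>

definition simple_model :: "'a \<Rightarrow> 'a model \<Rightarrow> bool"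
  where "simple_model s M \<longleftrightarrow>
    s \<in> symbols M \<and> ext M \<in> preds s M \<rightarrow>\<^sub>E Pow (lists (symbols M))"

definition sents :: "'a \<Rightarrow> 'a model \<Rightarrow> 'a list set"
  where "sents s M = {H @ X | H X. H \<in> preds s M \<and> X \<in> lists (symbols M)}"

definition sents_plus :: "'a \<Rightarrow> 'a model \<Rightarrow> 'a list set"
  where "sents_plus s M = sents s M - preds s M"

definition trues :: "'a \<Rightarrow> 'a model \<Rightarrow> 'a list set"
  where "trues s M = {H @ X | H X. H @ X \<in> sents s M \<and> H \<in> preds s M \<and> X \<in> ext M H}"

definition trues_plus :: "'a \<Rightarrow> 'a model \<Rightarrow> 'a list set"
  where "trues_plus s M = trues s M \<inter> sents_plus s M"

definition falses :: "'a \<Rightarrow> 'a model \<Rightarrow> 'a list set"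
  where "falses s M = sents s M - trues s M"

definition falses_plus :: "'a \<Rightarrow> 'a model \<Rightarrow> 'a list set"
  where "falses_plus s M = sents_plus s M - trues_plus s M"

end

theory Submission
  imports Defs
begin

text \<open>
  Over the one-letter alphabet \<open>{\<sharp>}\<close> the only predicate is \<open>\<sharp>\<close>, and the sentences are the strings
  \<open>\<sharp>\<^sup>n\<close> with \<open>n \<ge> 1\<close>. Let \<open>\<sharp>\<close> apply to the strings of even length. Then \<open>\<sharp>\<^sup>n\<close> is true iff \<open>n\<close> is
  odd, so among the sentences the extension of \<open>\<sharp>\<close> consists exactly of the false ones, whereas
  the empty string, which is not a sentence, separates it from the set of false sentences.
\<close>

definition parity_model :: "'a \<Rightarrow> 'a model"
  where "parity_model s =
    \<lparr>symbols = {s}, ext = (\<lambda>H\<in>{[s]}. {X \<in> lists {s}. even (length X)})\<rparr>"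

lemma symbols_parity_model [simp]: "symbols (parity_model s) = {s}"
  by (simp add: parity_model_def)

lemma ext_parity_model: "ext (parity_model s) = (\<lambda>H\<in>{[s]}. {X \<in> lists {s}. even (length X)})"
  by (simp add: parity_model_def)

lemma ext_parity_model_sharp [simp]:
  "ext (parity_model s) [s] = {X \<in> lists {s}. even (length X)}"
  by (simp add: ext_parity_model)

lemma preds_parity_model [simp]: "preds s (parity_model s) = {[s]}"
proof -
  have "X = []" if "X \<in> lists {s}" "s \<notin> set X" for X
    using that by (cases X) auto
  then show ?thesis
    by (auto simp: preds_def)
qed

lemma simple_model_parity_model: "simple_model s (parity_model s)"
  by (auto simp: simple_model_def ext_parity_model)

lemma sents_parity_model: "sents s (parity_model s) = lists {s} - {[]}"
proof (intro set_eqI iffI)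
  fix X
  assume "X \<in> lists {s} - {[]}"
  then show "X \<in> sents s (parity_model s)"
    by (cases X) (auto simp: sents_def)
qed (auto simp: sents_def)

text \<open>Splitting off the predicate \<open>[s]\<close> shortens a string by one, which turns the
  even lengths in the extension into odd ones.\<close>

lemma trues_parity_model: "trues s (parity_model s) = {X \<in> lists {s}. odd (length X)}"
proof (intro set_eqI iffI)
  fix X
  assume "X \<in> {X \<in> lists {s}. odd (length X)}"
  then show "X \<in> trues s (parity_model s)"
    by (cases X) (auto simp: trues_def sents_parity_model)
qed (auto simp: trues_def)

theorem proposition4p8:
  fixes s :: 'a
  shows "\<exists>M :: 'a model. simple_model s M \<and>
    \<not> (\<exists>H \<in> preds s M. trues_plus s M = ext M H \<inter> sents_plus s M) \<and>
    \<not> (\<exists>H \<in> preds s M. ext M H = falses s M) \<and>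
    (\<exists>H \<in> preds s M. falses_plus s M = ext M H \<inter> sents_plus s M)"
proof (intro exI conjI)
  let ?M = "parity_model s"
  show "simple_model s ?M"
    by (rule simple_model_parity_model)
  \<comment> \<open>The shortest sentence that is not a predicate has even length, so it lies in the
    extension of \<open>[s]\<close> but is false.\<close>
  have "[s, s] \<in> ext ?M [s] \<inter> sents_plus s ?M" and "[s, s] \<notin> trues_plus s ?M"
    by (simp_all add: sents_plus_def trues_plus_def sents_parity_model trues_parity_model)
  then show "\<not> (\<exists>H \<in> preds s ?M. trues_plus s ?M = ext ?M H \<inter> sents_plus s ?M)"
    by auto
  have "[] \<in> ext ?M [s]" and "[] \<notin> falses s ?M"
    by (simp_all add: falses_def sents_parity_model)
  then show "\<not> (\<exists>H \<in> preds s ?M. ext ?M H = falses s ?M)"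
    by auto
  \<comment> \<open>Intersecting with \<open>sents_plus\<close> discards the empty string, the only
    point where the extension and the set of false sentences differ.\<close>
  have "falses_plus s ?M = ext ?M [s] \<inter> sents_plus s ?M"
    by (auto simp: falses_plus_def trues_plus_def sents_plus_def
        sents_parity_model trues_parity_model)
  then show "\<exists>H \<in> preds s ?M. falses_plus s ?M = ext ?M H \<inter> sents_plus s ?M"
    by simp
qed

end
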